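(* Let $G$ be a graph (parallel edges allowed) and $\delta$ a finite or infinite cardinal. Define a relation $\approx_\delta$ on $V(G)$ by $a \approx_\delta b$ if $G$ contains $\delta$ pairwise edge-disjoint $a{-}b$ paths that are pairwise order-compatible. Then $\approx_\delta$ is an equivalence relation on $V(G)$.
   Context: Graphs may have parallel edges but no loops. Two $a{-}b$ paths are order-compatible if their common vertices occur in the same order when travelling along each of them from $a$ to $b$. *)

theory Defs
  imports Main
begin

text \<open>Undirected graphs with parallel edges but no loops: edges are objects in their own right, each
  with a two-element set of ends. Vertex and edge sets may be infinite.\<close>

record ('v, 'e) multigraph =
  verts :: "'v set"
  edges :: "'e set"
  ends :: "'e \<Rightarrow> 'v set"

definition is_multigraph :: "('v, 'e) multigraph \<Rightarrow> bool" where
  "is_multigraph G \<longleftrightarrow> (\<forall>e \<in> edges G. ends G e \<subseteq> verts G \<and> card (ends G e) = 2)"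

text \<open>A path is given by its vertex sequence and its edge sequence, as traversed from \<open>a\<close> to \<open>b\<close>.
  Paths do not repeat vertices, so the only path from \<open>a\<close> to \<open>a\<close> is the trivial one, \<open>([a], [])\<close>.\<close>

type_synonym ('v, 'e) path = "'v list \<times> 'e list"

definition path_verts :: "('v, 'e) path \<Rightarrow> 'v list" where
  "path_verts p = fst p"

definition path_edges :: "('v, 'e) path \<Rightarrow> 'e list" where
  "path_edges p = snd p"

definition is_path :: "('v, 'e) multigraph \<Rightarrow> 'v \<Rightarrow> 'v \<Rightarrow> ('v, 'e) path \<Rightarrow> bool" where
  "is_path G a b p \<longleftrightarrow>
     length (path_verts p) = Suc (length (path_edges p)) \<and>
     distinct (path_verts p) \<and>
     set (path_verts p) \<subseteq> verts G \<and>
     set (path_edges p) \<subseteq> edges G \<and>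
     (\<forall>i < length (path_edges p).
        ends G (path_edges p ! i) = {path_verts p ! i, path_verts p ! Suc i}) \<and>
     hd (path_verts p) = a \<and> last (path_verts p) = b"

definition edge_disjoint :: "('v, 'e) path \<Rightarrow> ('v, 'e) path \<Rightarrow> bool" where
  "edge_disjoint p q \<longleftrightarrow> set (path_edges p) \<inter> set (path_edges q) = {}"

definition precedes :: "('v, 'e) path \<Rightarrow> 'v \<Rightarrow> 'v \<Rightarrow> bool" where
  "precedes p x y \<longleftrightarrow>
     (\<exists>i j. i < j \<and> j < length (path_verts p) \<and> path_verts p ! i = x \<and> path_verts p ! j = y)"

definition order_compatible :: "('v, 'e) path \<Rightarrow> ('v, 'e) path \<Rightarrow> bool" where
  "order_compatible p q \<longleftrightarrow>
     (\<forall>x \<in> set (path_verts p) \<inter> set (path_verts q).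
      \<forall>y \<in> set (path_verts p) \<inter> set (path_verts q). precedes p x y \<longleftrightarrow> precedes q x y)"

text \<open>The cardinal \<open>\<delta>\<close> is a cardinal order in the sense of \<open>Card_order\<close>, so \<open>Field \<delta>\<close> is a set of
  cardinality \<open>\<delta>\<close> and serves as index set for a family of \<open>\<delta>\<close> paths. For \<open>a \<noteq> b\<close> the members of a
  pairwise edge-disjoint family are automatically distinct; for \<open>a = b\<close> the trivial path, which is
  edge-disjoint from itself, may be repeated.\<close>

definition edge_rel :: "('v, 'e) multigraph \<Rightarrow> 'k rel \<Rightarrow> ('v \<times> 'v) set" where
  "edge_rel G \<delta> = {(a, b). a \<in> verts G \<and> b \<in> verts G \<and>
     (\<exists>P :: 'k \<Rightarrow> ('v, 'e) path.
        (\<forall>i \<in> Field \<delta>. is_path G a b (P i)) \<and>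
        (\<forall>i \<in> Field \<delta>. \<forall>j \<in> Field \<delta>. i \<noteq> j \<longrightarrow>
           edge_disjoint (P i) (P j) \<and> order_compatible (P i) (P j)))}"

end

theory Submission
  imports Defs
begin

text \<open>Only transitivity needs work. Given paths \<open>P\<^sub>i\<close> from \<open>a\<close> to \<open>b\<close> and \<open>Q\<^sub>j\<close> from \<open>b\<close> to \<open>c\<close>, match
  each \<open>P\<^sub>i\<close> with some \<open>Q\<^sub>j\<close> at a common vertex, where \<open>P\<^sub>i\<close> prefers to leave early (close to \<open>a\<close>) and
  \<open>Q\<^sub>j\<close> prefers to be entered late (close to \<open>c\<close>). A stable matching exists by the Knaster--Tarski
  theorem, also for infinitely many paths. Every \<open>P\<^sub>i\<close> can be matched with every \<open>Q\<^sub>j\<close> at \<open>b\<close>, so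
  stability forces all \<open>P\<^sub>i\<close> or all \<open>Q\<^sub>j\<close> to be matched, and following \<open>P\<^sub>i\<close> up to the switching vertex
  and its partner from there on gives \<open>\<delta>\<close> walks from \<open>a\<close> to \<open>c\<close>. Stability also says that an initial
  segment of a \<open>P\<^sub>i\<close> and a final segment of a \<open>Q\<^sub>j\<close> in use meet at most in one of the two switching
  vertices, which makes these walks order-compatible paths. To make them edge-disjoint, ties between
  partners entering \<open>Q\<^sub>j\<close> at the same vertex are broken in favour of the one whose next edge is also
  the next edge of \<open>Q\<^sub>j\<close>.\<close>

section \<open>Stable matchings\<close>

text \<open>Compare by \<open>f\<close> first and break ties by a well-order of the whole type. Both
  components are well-founded, so strict preferences without infinite descent arise from ranks with
  ties.\<close>

lemma wf_total_refinement:
  fixes f :: "'a \<Rightarrow> nat"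
  shows "\<exists>R. wf R \<and> total R \<and> (\<forall>x y. (x, y) \<in> R \<longrightarrow> f x \<le> f y)"
proof -
  obtain r :: "'a rel" where r: "well_order_on UNIV r"
    using well_order_on by blast
  let ?R = "inv_image (less_than <*lex*> (r - Id)) (\<lambda>x. (f x, x))"
  have "wf ?R"
    using r by (auto simp: well_order_on_def)
  moreover have "total ?R"
    using r by (auto simp: well_order_on_def linear_order_on_def total_on_def)
  moreover have "\<forall>x y. (x, y) \<in> ?R \<longrightarrow> f x \<le> f y"
    by auto
  ultimately show ?thesis
    by blast
qed

text \<open>An element of \<open>C\<close> is a possible match between its ends under
  \<open>p\<close> and \<open>q\<close>; lower \<open>\<rho>\<close> or \<open>\<sigma>\<close> is
  better for the respective end. The fixed point plays the role of deferred acceptance: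
  \<open>X\<close> and \<open>Y\<close> are the matches open to the two sides, each being what the
  other side does not reject.\<close>

lemma stable_matching_exists:
  fixes C :: "'c set" and p :: "'c \<Rightarrow> 'a" and q :: "'c \<Rightarrow> 'b" and \<rho> \<sigma> :: "'c \<Rightarrow> nat"
  obtains M where "M \<subseteq> C" "inj_on p M" "inj_on q M"
    "\<And>c. c \<in> C \<Longrightarrow> \<exists>m\<in>M. p m = p c \<and> \<rho> m \<le> \<rho> c \<or> q m = q c \<and> \<sigma> m \<le> \<sigma> c"
proof -
  obtain R where R: "wf R" "total R" "\<And>x y. (x, y) \<in> R \<Longrightarrow> \<rho> x \<le> \<rho> y"
    using wf_total_refinement[of \<rho>] by blast
  obtain S where S: "wf S" "total S" "\<And>x y. (x, y) \<in> S \<Longrightarrow> \<sigma> x \<le> \<sigma> y"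
    using wf_total_refinement[of \<sigma>] by blast
  define rej_p where "rej_p X = {c \<in> X. \<exists>d\<in>X. p d = p c \<and> (d, c) \<in> R}" for X
  define rej_q where "rej_q X = {c \<in> X. \<exists>d\<in>X. q d = q c \<and> (d, c) \<in> S}" for X
  \<comment> \<open>Rejections grow with the set of offers, so each complement reverses inclusion
    and the two together preserve it.\<close>
  have "mono (\<lambda>X. C - rej_q (C - rej_p X))"
    by (rule monoI) (auto simp: rej_p_def rej_q_def)
  then obtain X where X: "X = C - rej_q (C - rej_p X)"
    using lfp_unfold by blast
  define Y where "Y = C - rej_p X"
  have XY: "X = C - rej_q Y" "X \<subseteq> C" "Y \<subseteq> C"
    using X by (auto simp: Y_def)
  define M where "M = X \<inter> Y"
  have M_p: "M = X - rej_p X" and M_q: "M = Y - rej_q Y"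
    using XY by (auto simp: M_def Y_def)
  \<comment> \<open>A rejected element of \<open>X\<close> has an \<open>R\<close>-smaller rival at
    the same end. Well-founded descent stops at one that is not rejected, and this lies in
    \<open>M\<close>.\<close>
  have best_p: "\<exists>m\<in>M. p m = p c \<and> \<rho> m \<le> \<rho> c" if "c \<in> X" for c
    using R(1) that
  proof (induction c rule: wf_induct_rule)
    case (less c)
    show ?case
    proof (cases "c \<in> M")
      case False
      then obtain d where "d \<in> X" "p d = p c" "(d, c) \<in> R"
        using less.prems by (auto simp: M_p rej_p_def)
      then show ?thesis
        using less.IH[of d] R(3)[of d c] by force
    qed blast
  qed
  have best_q: "\<exists>m\<in>M. q m = q c \<and> \<sigma> m \<le> \<sigma> c" if "c \<in> Y" for c
    using S(1) that
  proof (induction c rule: wf_induct_rule)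
    case (less c)
    show ?case
    proof (cases "c \<in> M")
      case False
      then obtain d where "d \<in> Y" "q d = q c" "(d, c) \<in> S"
        using less.prems by (auto simp: M_q rej_q_def)
      then show ?thesis
        using less.IH[of d] S(3)[of d c] by force
    qed blast
  qed
  show thesis
  proof
    show "M \<subseteq> C"
      using XY by (auto simp: M_def)
    show "inj_on p M"
    proof (rule inj_onI)
      fix c d assume "c \<in> M" "d \<in> M" "p c = p d"
      then show "c = d"
        using \<open>total R\<close> by (auto simp: M_p rej_p_def total_on_def)
    qed
    show "inj_on q M"
    proof (rule inj_onI)
      fix c d assume "c \<in> M" "d \<in> M" "q c = q d"
      then show "c = d"
        using \<open>total S\<close> by (auto simp: M_q rej_q_def total_on_def)
    qed
    show "\<exists>m\<in>M. p m = p c \<and> \<rho> m \<le> \<rho> c \<or> q m = q c \<and> \<sigma> m \<le> \<sigma> c" if "c \<in> C" for c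
    proof (cases "c \<in> X")
      case True
      then show ?thesis using best_p by blast
    next
      case False
      \<comment> \<open>The fixed point lets an element of \<open>C\<close> fall outside
        \<open>X\<close> only by rejection from \<open>Y\<close>.\<close>
      then have "c \<in> Y"
        using that XY by (auto simp: rej_q_def)
      then show ?thesis using best_q by blast
    qed
  qed
qed

section \<open>Paths\<close>

lemma is_pathD:
  assumes "is_path G a b p"
  shows "length (path_verts p) = Suc (length (path_edges p))" "distinct (path_verts p)"
    "set (path_verts p) \<subseteq> verts G" "set (path_edges p) \<subseteq> edges G"
    "\<And>i. i < length (path_edges p) \<Longrightarrow>
      ends G (path_edges p ! i) = {path_verts p ! i, path_verts p ! Suc i}"
    "path_verts p ! 0 = a" "path_verts p ! length (path_edges p) = b"
proof -
  have "path_verts p \<noteq> []"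
    using assms by (auto simp: is_path_def)
  then show "path_verts p ! 0 = a" "path_verts p ! length (path_edges p) = b"
    using assms by (auto simp: is_path_def hd_conv_nth last_conv_nth)
qed (use assms in \<open>auto simp: is_path_def\<close>)

lemma is_pathI:
  assumes "length (path_verts p) = Suc (length (path_edges p))" "distinct (path_verts p)"
    "set (path_verts p) \<subseteq> verts G" "set (path_edges p) \<subseteq> edges G"
    "\<And>i. i < length (path_edges p) \<Longrightarrow>
      ends G (path_edges p ! i) = {path_verts p ! i, path_verts p ! Suc i}"
    "path_verts p ! 0 = a" "path_verts p ! length (path_edges p) = b"
  shows "is_path G a b p"
proof -
  have "path_verts p \<noteq> []"
    using assms(1) by auto
  then show ?thesis
    using assms by (auto simp: is_path_def hd_conv_nth last_conv_nth)
qed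

text \<open>On a path without repeated vertices, \<open>precedes\<close> is a strict total order of
  its vertices, so two such orders disagree only through a pair in opposite order.\<close>

lemma order_compatible_iff:
  assumes "distinct (path_verts p)" "distinct (path_verts q)"
  shows "order_compatible p q \<longleftrightarrow> (\<nexists>x y. precedes p x y \<and> precedes q y x)"
proof -
  have mem: "x \<in> set (path_verts r)" "y \<in> set (path_verts r)" if "precedes r x y"
    for r :: "('a, 'b) path" and x y
    using that by (auto simp: precedes_def)
  have asym: "\<not> precedes r y x" if "precedes r x y" "distinct (path_verts r)"
    for r :: "('a, 'b) path" and x y
    using that by (auto simp: precedes_def nth_eq_iff_index_eq)
  have total: "precedes r x y \<or> precedes r y x"
    if "x \<in> set (path_verts r)" "y \<in> set (path_verts r)" "x \<noteq> y"
    for r :: "('a, 'b) path" and x y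
    using that unfolding precedes_def in_set_conv_nth by (metis linorder_neqE_nat)
  show ?thesis
  proof
    assume "order_compatible p q"
    then show "\<nexists>x y. precedes p x y \<and> precedes q y x"
      using mem asym assms(2) unfolding order_compatible_def by (meson IntI)
  next
    assume ne: "\<nexists>x y. precedes p x y \<and> precedes q y x"
    have "precedes p x y \<longleftrightarrow> precedes q x y"
      if "x \<in> set (path_verts p) \<inter> set (path_verts q)"
        "y \<in> set (path_verts p) \<inter> set (path_verts q)" for x y
    proof (cases "x = y")
      case True
      then show ?thesis
        using asym assms by blast
    next
      case False
      then show ?thesis
        using total[of x p y] total[of x q y] that ne asym assms by blast
    qed
    then show "order_compatible p q"
      unfolding order_compatible_def by blast
  qed
qed

lemma is_path_rev:
  assumes "is_path G a b p"
  shows "is_path G b a (map_prod rev rev p)"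
proof (rule is_pathI)
  note p = is_pathD[OF assms]
  let ?r = "map_prod rev rev p"
  have sel: "path_verts ?r = rev (path_verts p)" "path_edges ?r = rev (path_edges p)"
    by (simp_all add: path_verts_def path_edges_def)
  show "length (path_verts ?r) = Suc (length (path_edges ?r))" "distinct (path_verts ?r)"
    "set (path_verts ?r) \<subseteq> verts G" "set (path_edges ?r) \<subseteq> edges G"
    using p by (simp_all add: sel)
  show "path_verts ?r ! 0 = b" "path_verts ?r ! length (path_edges ?r) = a"
    using p by (simp_all add: sel rev_nth)
  show "ends G (path_edges ?r ! i) = {path_verts ?r ! i, path_verts ?r ! Suc i}"
    if "i < length (path_edges ?r)" for i
    using that p(1) p(5)[of "length (path_edges p) - Suc i"]
    by (auto simp: sel rev_nth Suc_diff_Suc)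
qed

lemma precedes_rev: "precedes (map_prod rev rev p) x y \<longleftrightarrow> precedes p y x"
proof -
  have imp: "precedes (map_prod rev rev p) x y" if pre: "precedes p y x" for p :: "('a, 'b) path" and x y
  proof -
    obtain i j where ij: "i < j" "j < length (path_verts p)" "path_verts p ! i = y" "path_verts p ! j = x"
      using pre by (auto simp: precedes_def)
    let ?n = "length (path_verts p)"
    have "?n - Suc j < ?n - Suc i" "?n - Suc i < ?n"
      "rev (path_verts p) ! (?n - Suc j) = x" "rev (path_verts p) ! (?n - Suc i) = y"
      using ij by (auto simp: rev_nth Suc_diff_Suc)
    then show ?thesis
      by (fastforce simp: precedes_def path_verts_def)
  qed
  \<comment> \<open>Reversing twice is the identity, so the implication for the reversed path is the
    converse.\<close>
  show ?thesis
    using imp[of p y x] imp[of "map_prod rev rev p" x y] by (auto simp: map_prod_def split: prod.splits)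
qed

text \<open>The switching vertex is taken from \<open>q\<close> only, so it is listed once and the
  same \<open>k\<close> and \<open>l\<close> serve for vertices and edges.\<close>

definition switch :: "('v, 'e) path \<Rightarrow> nat \<Rightarrow> ('v, 'e) path \<Rightarrow> nat \<Rightarrow> ('v, 'e) path" where
  "switch p k q l = (take k (path_verts p) @ drop l (path_verts q),
                     take k (path_edges p) @ drop l (path_edges q))"

text \<open>In \<open>only_meet\<close> strict indices suffice: at \<open>s = k\<close> or
  \<open>t = l\<close> the vertex lies on both paths, and distinctness of one of them rules out a
  repetition.\<close>

locale switched_path =
  fixes G :: "('v, 'e) multigraph" and a b c p q k l
  assumes p: "is_path G a b p" and q: "is_path G b c q"
    and k: "k \<le> length (path_edges p)" and l: "l \<le> length (path_edges q)"
    and meet: "path_verts p ! k = path_verts q ! l"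
    and only_meet: "\<And>s t. s < k \<Longrightarrow> l < t \<Longrightarrow> t \<le> length (path_edges q) \<Longrightarrow>
          path_verts p ! s \<noteq> path_verts q ! t"
begin

abbreviation "r \<equiv> switch p k q l"

lemma length_edges: "length (path_edges r) = k + (length (path_edges q) - l)"
  using k by (simp add: switch_def path_edges_def)

lemma length_verts: "length (path_verts r) = Suc (k + (length (path_edges q) - l))"
  using k l is_pathD(1)[OF p] is_pathD(1)[OF q] by (simp add: switch_def path_verts_def)

text \<open>By \<open>meet\<close> this and \<open>nth_final\<close> both hold at position
  \<open>k\<close>, so the switching vertex may be counted with either segment.\<close>

lemma nth_initial: "s \<le> k \<Longrightarrow> path_verts r ! s = path_verts p ! s"
  using k l is_pathD(1)[OF p] is_pathD(1)[OF q] meet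
  by (auto simp: switch_def path_verts_def nth_append)

lemma nth_final: "k \<le> s \<Longrightarrow> path_verts r ! s = path_verts q ! (l + (s - k))"
  using k l is_pathD(1)[OF p] is_pathD(1)[OF q]
  by (auto simp: switch_def path_verts_def nth_append)

lemma edge_initial: "s < k \<Longrightarrow> path_edges r ! s = path_edges p ! s"
  using k by (auto simp: switch_def path_edges_def nth_append)

lemma edge_final: "k \<le> s \<Longrightarrow> path_edges r ! s = path_edges q ! (l + (s - k))"
  using k l by (auto simp: switch_def path_edges_def nth_append)

lemma is_path: "is_path G a c r"
proof (rule is_pathI)
  note P = is_pathD[OF p] and Q = is_pathD[OF q]
  show "length (path_verts r) = Suc (length (path_edges r))"
    by (simp add: length_verts length_edges)
  have "path_verts r ! s \<noteq> path_verts r ! t" if "s < t" "t < length (path_verts r)" for s t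
  proof -
    consider "t \<le> k" | "k \<le> s" | "s < k" "k < t"
      by linarith
    then show ?thesis
    proof cases
      case 1
      then show ?thesis
        using that k P(1,2) by (simp add: nth_initial nth_eq_iff_index_eq)
    next
      case 2
      then show ?thesis
        using that l Q(1,2) by (simp add: nth_final nth_eq_iff_index_eq length_verts)
    next
      case 3
      then show ?thesis
        using that l only_meet[of s "l + (t - k)"] by (simp add: nth_initial nth_final length_verts)
    qed
  qed
  then show "distinct (path_verts r)"
    unfolding distinct_conv_nth by (metis linorder_neqE_nat)
  show "set (path_verts r) \<subseteq> verts G"
    using P(3) Q(3) by (auto simp: switch_def path_verts_def dest: in_set_takeD in_set_dropD)
  show "set (path_edges r) \<subseteq> edges G"
    using P(4) Q(4) by (auto simp: switch_def path_edges_def dest: in_set_takeD in_set_dropD)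
  show "path_verts r ! 0 = a"
    using P(6) by (simp add: nth_initial)
  show "path_verts r ! length (path_edges r) = c"
    using Q(7) l by (simp add: nth_final length_edges)
  show "ends G (path_edges r ! s) = {path_verts r ! s, path_verts r ! Suc s}"
    if "s < length (path_edges r)" for s
  proof (cases "s < k")
    case True
    then show ?thesis
      using k P(5)[of s] by (simp add: edge_initial nth_initial)
  next
    case False
    then show ?thesis
      using that l Q(5)[of "l + (s - k)"]
      by (simp add: edge_final nth_final length_edges Suc_diff_le)
  qed
qed

end

section \<open>The relation\<close>

lemma edge_rel_refl:
  assumes "a \<in> verts G"
  shows "(a, a) \<in> edge_rel G \<delta>"
proof -
  have "is_path G a a ([a], [])"
    using assms by (auto simp: is_path_def path_verts_def path_edges_def)
  then show ?thesis
    using assms unfolding edge_rel_def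
    by (auto intro!: exI[of _ "\<lambda>_. ([a], [])"]
        simp: edge_disjoint_def order_compatible_def path_edges_def)
qed

text \<open>Reversing all paths keeps their edge sets and inverts all vertex orders
  simultaneously.\<close>

lemma edge_rel_sym:
  assumes "(a, b) \<in> edge_rel G \<delta>"
  shows "(b, a) \<in> edge_rel G \<delta>"
proof -
  obtain P where P: "a \<in> verts G" "b \<in> verts G" "\<forall>i \<in> Field \<delta>. is_path G a b (P i)"
    "\<forall>i \<in> Field \<delta>. \<forall>j \<in> Field \<delta>. i \<noteq> j \<longrightarrow>
       edge_disjoint (P i) (P j) \<and> order_compatible (P i) (P j)"
    using assms by (auto simp: edge_rel_def)
  let ?R = "\<lambda>i. map_prod rev rev (P i)"
  have "edge_disjoint (?R i) (?R j) \<and> order_compatible (?R i) (?R j)"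
    if "i \<in> Field \<delta>" "j \<in> Field \<delta>" "i \<noteq> j" for i j
  proof
    show "edge_disjoint (?R i) (?R j)"
      using P(4) that by (simp add: edge_disjoint_def path_edges_def)
    show "order_compatible (?R i) (?R j)"
    proof -
      have "order_compatible (P i) (P j)"
        using P(4) that by blast
      moreover have "set (path_verts (map_prod rev rev p)) = set (path_verts p)"
        for p :: "('a, 'b) path"
        by (simp add: path_verts_def)
      ultimately show ?thesis
        by (simp only: order_compatible_def precedes_rev) blast
    qed
  qed
  then show ?thesis
    using P unfolding edge_rel_def by (auto intro!: exI[of _ ?R] is_path_rev)
qed

lemma edge_rel_trans:
  assumes "(a, b) \<in> edge_rel G \<delta>" "(b, c) \<in> edge_rel G \<delta>"
  shows "(a, c) \<in> edge_rel G \<delta>"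
proof -
  obtain P where P: "\<And>i. i \<in> Field \<delta> \<Longrightarrow> is_path G a b (P i)"
    "\<And>i j. i \<in> Field \<delta> \<Longrightarrow> j \<in> Field \<delta> \<Longrightarrow> i \<noteq> j \<Longrightarrow> edge_disjoint (P i) (P j)"
    "\<And>i j. i \<in> Field \<delta> \<Longrightarrow> j \<in> Field \<delta> \<Longrightarrow> i \<noteq> j \<Longrightarrow> order_compatible (P i) (P j)"
    using assms(1) unfolding edge_rel_def by blast
  obtain Q where Q: "\<And>i. i \<in> Field \<delta> \<Longrightarrow> is_path G b c (Q i)"
    "\<And>i j. i \<in> Field \<delta> \<Longrightarrow> j \<in> Field \<delta> \<Longrightarrow> i \<noteq> j \<Longrightarrow> edge_disjoint (Q i) (Q j)"
    "\<And>i j. i \<in> Field \<delta> \<Longrightarrow> j \<in> Field \<delta> \<Longrightarrow> i \<noteq> j \<Longrightarrow> order_compatible (Q i) (Q j)"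
    using assms(2) unfolding edge_rel_def by blast

  \<comment> \<open>Possible switches and their ranks\<close>
  let ?I = "Field \<delta>"
  define pe where "pe i = length (path_edges (P i))" for i
  define qe where "qe j = length (path_edges (Q j))" for j
  \<comment> \<open>The two paths leave the switching vertex along the same edge.\<close>
  define share where "share i j k l \<longleftrightarrow>
    k < pe i \<and> l < qe j \<and> path_edges (P i) ! k = path_edges (Q j) ! l" for i j k l
  define C where "C = {(i, j, k, l). i \<in> ?I \<and> j \<in> ?I \<and> k \<le> pe i \<and> l \<le> qe j \<and>
    path_verts (P i) ! k = path_verts (Q j) ! l}"
  \<comment> \<open>The factor 2 makes the distance to \<open>c\<close> along \<open>Q j\<close>
    decisive; the last bit only breaks ties at the same vertex.\<close>
  define \<sigma> where "\<sigma> = (\<lambda>(i, j, k, l). 2 * (qe j - l) + (if share i j k l then 0 else 1))"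
  obtain M where M: "M \<subseteq> C" "inj_on fst M" "inj_on (fst \<circ> snd) M"
    and stable: "\<And>x. x \<in> C \<Longrightarrow> \<exists>m\<in>M. fst m = fst x \<and> (fst \<circ> snd \<circ> snd) m \<le> (fst \<circ> snd \<circ> snd) x \<or>
      (fst \<circ> snd) m = (fst \<circ> snd) x \<and> \<sigma> m \<le> \<sigma> x"
    by (rule stable_matching_exists[of C fst "fst \<circ> snd" "fst \<circ> snd \<circ> snd" \<sigma>]) blast
  have in_C: "i \<in> ?I" "j \<in> ?I" "k \<le> pe i" "l \<le> qe j" "path_verts (P i) ! k = path_verts (Q j) ! l"
    if "(i, j, k, l) \<in> M" for i j k l
    using M(1) that by (auto simp: C_def)

  \<comment> \<open>Consequences of stability\<close>
  have no_block: "k \<le> s \<or> \<sigma> (i', j', k', l') \<le> \<sigma> (i, j', s, t)"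
    if m: "(i, j, k, l) \<in> M" "(i', j', k', l') \<in> M" and s: "s \<le> pe i" and t: "t \<le> qe j'"
      and eq: "path_verts (P i) ! s = path_verts (Q j') ! t" for i j k l i' j' k' l' s t
  proof -
    have "(i, j', s, t) \<in> C"
      using s t eq in_C[OF m(1)] in_C[OF m(2)] by (auto simp: C_def)
    \<comment> \<open>Injectivity of \<open>fst\<close> and \<open>fst \<circ> snd\<close> on
      \<open>M\<close> identifies the stabilizing match with the given match of \<open>i\<close> or
      of \<open>j'\<close>.\<close>
    from stable[OF this] obtain i1 j1 k1 l1 where m1: "(i1, j1, k1, l1) \<in> M"
      and or: "i1 = i \<and> k1 \<le> s \<or> j1 = j' \<and> \<sigma> (i1, j1, k1, l1) \<le> \<sigma> (i, j', s, t)"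
      by fastforce
    from or show ?thesis
    proof
      assume "i1 = i \<and> k1 \<le> s"
      then show ?thesis
        using inj_onD[OF M(2) _ m1 m(1)] by auto
    next
      assume "j1 = j' \<and> \<sigma> (i1, j1, k1, l1) \<le> \<sigma> (i, j', s, t)"
      then show ?thesis
        using inj_onD[OF M(3) _ m1 m(2)] by auto
    qed
  qed
  have cross: "s = k \<or> t = l'"
    if m: "(i, j, k, l) \<in> M" "(i', j', k', l') \<in> M" and s: "s \<le> k" and t: "l' \<le> t" "t \<le> qe j'"
      and eq: "path_verts (P i) ! s = path_verts (Q j') ! t" for i j k l i' j' k' l' s t
  proof (rule ccontr)
    assume "\<not> (s = k \<or> t = l')"
    then have "s < k" "l' < t"
      using s t by auto
    \<comment> \<open>Both sides would gain: one step closer to \<open>c\<close> lowers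
      \<open>\<sigma>\<close> by 2, more than the tie bit can offset.\<close>
    then show False
      using no_block[OF m _ t(2) eq] in_C(3)[OF m(1)] t(2) by (auto simp: \<sigma>_def split: if_splits)
  qed
  have edge_cross: False
    if m: "(i, j, k, l) \<in> M" "(i', j', k', l') \<in> M" and "i \<noteq> i'" and s: "s < k"
      and t: "l' \<le> t" "t < qe j'"
      and eq: "path_edges (P i) ! s = path_edges (Q j') ! t" for i j k l i' j' k' l' s t
  proof -
    note c = in_C[OF m(1)] and c' = in_C[OF m(2)]
    note Pi = is_pathD[OF P(1)[OF c(1)], folded pe_def]
      and Qj = is_pathD[OF Q(1)[OF c'(2)], folded qe_def]
    have s': "s < pe i"
      using s c(3) by simp
    have ends: "{path_verts (P i) ! s, path_verts (P i) ! Suc s} =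
        {path_verts (Q j') ! t, path_verts (Q j') ! Suc t}"
      using Pi(5)[OF s'] Qj(5)[OF t(2)] eq by simp
    \<comment> \<open>Since \<open>s < k\<close>, \<open>cross\<close> allows \<open>P i ! s\<close>
      to meet the final segment only at its first vertex. This leaves \<open>t = l'\<close>, where
      the tie bit decides.\<close>
    then consider "path_verts (P i) ! s = path_verts (Q j') ! t"
      | "path_verts (P i) ! s = path_verts (Q j') ! Suc t"
      by blast
    then show False
    proof cases
      case 1
      then have "t = l'"
        using cross[OF m, of s t] s t by auto
      have "share i j' s t"
        using eq s' t by (simp add: share_def)
      \<comment> \<open>The next edge of \<open>Q j'\<close> already belongs to \<open>P i\<close>,
        so the edge-disjoint \<open>P i'\<close> cannot use it. Hence the match with
        \<open>i\<close> would be strictly better.\<close>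
      moreover have "\<not> share i' j' k' l'"
      proof
        assume "share i' j' k' l'"
        then have "path_edges (P i') ! k' = path_edges (P i) ! s" "k' < pe i'"
          using eq \<open>t = l'\<close> by (auto simp: share_def)
        then have "path_edges (P i) ! s \<in> set (path_edges (P i)) \<inter> set (path_edges (P i'))"
          using s' by (metis IntI nth_mem pe_def)
        then show False
          using P(2)[OF c(1) c'(1) \<open>i \<noteq> i'\<close>] by (auto simp: edge_disjoint_def)
      qed
      ultimately show False
        using no_block[OF m, of s t] s s' t 1 \<open>t = l'\<close> by (auto simp: \<sigma>_def)
    next
      case 2
      then show False
        using cross[OF m, of s "Suc t"] s t by auto
    qed
  qed

  \<comment> \<open>The switched paths\<close>
  define R where "R = (\<lambda>(i, j, k, l). switch (P i) k (Q j) l)"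
  have sw: "switched_path G a b c (P i) (Q j) k l" if m: "(i, j, k, l) \<in> M" for i j k l
  proof
    \<comment> \<open>This is \<open>cross\<close> with both matches taken to be the same.\<close>
    show "path_verts (P i) ! s \<noteq> path_verts (Q j) ! t"
      if "s < k" "l < t" "t \<le> length (path_edges (Q j))" for s t
      using cross[OF m m, of s t] that by (auto simp: qe_def)
  qed (use in_C[OF m] P(1)[of i] Q(1)[of j] in \<open>auto simp: pe_def qe_def\<close>)
  have R_path: "is_path G a c (R m)" if "m \<in> M" for m
    using that switched_path.is_path[OF sw] by (cases m) (auto simp: R_def)

  \<comment> \<open>Edge-disjointness\<close>
  have R_disjoint: "edge_disjoint (R m) (R m')" if "m \<in> M" "m' \<in> M" "m \<noteq> m'" for m m'
  proof -
    obtain i j k l i' j' k' l' where mm: "m = (i, j, k, l)" "m' = (i', j', k', l')"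
      by (cases m, cases m')
    note m = that(1)[unfolded mm(1)] and m' = that(2)[unfolded mm(2)]
    have "fst m \<noteq> fst m'" "(fst \<circ> snd) m \<noteq> (fst \<circ> snd) m'"
      using inj_onD[OF M(2)] inj_onD[OF M(3)] that by blast+
    then have ne: "i \<noteq> i'" "j \<noteq> j'"
      by (simp_all add: mm)
    note c = in_C[OF m] and c' = in_C[OF m']
    have PP: "set (path_edges (P i)) \<inter> set (path_edges (P i')) = {}"
      using P(2)[OF c(1) c'(1) ne(1)] by (simp add: edge_disjoint_def)
    have QQ: "set (path_edges (Q j)) \<inter> set (path_edges (Q j')) = {}"
      using Q(2)[OF c(2) c'(2) ne(2)] by (simp add: edge_disjoint_def)
    \<comment> \<open>The indices are generalized because both orders of the two matches are
      needed.\<close>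
    have PQ: "set (take k (path_edges (P i))) \<inter> set (drop l' (path_edges (Q j'))) = {}"
      if m: "(i, j, k, l) \<in> M" and m': "(i', j', k', l') \<in> M" and ne: "i \<noteq> i'" for i j k l i' j' k' l'
    proof (rule ccontr)
      assume "\<not> ?thesis"
      then obtain s t where "s < k" "t < qe j' - l'"
        "path_edges (P i) ! s = path_edges (Q j') ! (l' + t)"
        using in_C(4)[OF m'] by (fastforce simp: in_set_conv_nth qe_def)
      then show False
        using edge_cross[OF m m' ne, of s "l' + t"] by linarith
    qed
    show ?thesis
      using PP QQ PQ[OF m m' ne(1)] PQ[OF m' m ne(1)[symmetric]]
      by (auto simp: mm R_def edge_disjoint_def switch_def path_edges_def
          dest: in_set_takeD in_set_dropD)
  qed

  \<comment> \<open>Order-compatibility\<close>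
  have R_compatible: "order_compatible (R m) (R m')" if "m \<in> M" "m' \<in> M" "m \<noteq> m'" for m m'
  proof -
    obtain i j k l i' j' k' l' where mm: "m = (i, j, k, l)" "m' = (i', j', k', l')"
      by (cases m, cases m')
    note m = that(1)[unfolded mm(1)] and m' = that(2)[unfolded mm(2)]
    have "fst m \<noteq> fst m'" "(fst \<circ> snd) m \<noteq> (fst \<circ> snd) m'"
      using inj_onD[OF M(2)] inj_onD[OF M(3)] that by blast+
    then have ne: "i \<noteq> i'" "j \<noteq> j'"
      by (simp_all add: mm)
    note c = in_C[OF m] and c' = in_C[OF m']
    interpret sw: switched_path G a b c "P i" "Q j" k l by (rule sw[OF m])
    interpret sw': switched_path G a b c "P i'" "Q j'" k' l' by (rule sw[OF m'])
    have Rm: "R m = sw.r" "R m' = sw'.r"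
      by (simp_all add: R_def mm)
    have dist: "distinct (path_verts (R m))" "distinct (path_verts (R m'))"
      by (rule is_pathD(2)[OF R_path[OF that(1)]], rule is_pathD(2)[OF R_path[OF that(2)]])
    have len: "length (path_verts (P i)) = Suc (pe i)" "length (path_verts (P i')) = Suc (pe i')"
      "length (path_verts (Q j)) = Suc (qe j)" "length (path_verts (Q j')) = Suc (qe j')"
      using c c' by (simp_all add: is_pathD(1)[OF P(1)] is_pathD(1)[OF Q(1)] pe_def qe_def)
    \<comment> \<open>A common vertex lies on both initial or on both final segments, switching
      vertices counting as either; \<open>cross\<close> forbids the mixed case.\<close>
    have common: "s \<le> k \<and> s' \<le> k' \<or> k \<le> s \<and> k' \<le> s'"
      if "s \<le> k + (qe j - l)" "s' \<le> k' + (qe j' - l')"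
        and eq: "path_verts sw.r ! s = path_verts sw'.r ! s'" for s s'
    proof (rule ccontr)
      assume "\<not> ?thesis"
      then consider "s < k" "k' < s'" | "k < s" "s' < k'"
        by linarith
      then show False
      proof cases
        case 1
        then have "path_verts (P i) ! s = path_verts (Q j') ! (l' + (s' - k'))"
          using eq by (simp only: sw.nth_initial sw'.nth_final less_imp_le)
        then show False
          using 1 that(2) c'(4) cross[OF m m', of s "l' + (s' - k')"] by linarith
      next
        case 2
        then have "path_verts (P i') ! s' = path_verts (Q j) ! (l + (s - k))"
          using eq by (simp only: sw'.nth_initial sw.nth_final less_imp_le)
        then show False
          using 2 that(1) c(4) cross[OF m' m, of s' "l + (s - k)"] by linarith
      qed
    qed
    have False if pre: "precedes (R m) x y" "precedes (R m') y x" for x y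
    proof -
      obtain s t where st: "s < t" "t \<le> k + (qe j - l)"
        "path_verts sw.r ! s = x" "path_verts sw.r ! t = y"
        using pre(1) by (auto simp: precedes_def Rm sw.length_verts qe_def)
      obtain s' t' where st': "t' < s'" "s' \<le> k' + (qe j' - l')"
        "path_verts sw'.r ! s' = x" "path_verts sw'.r ! t' = y"
        using pre(2) by (auto simp: precedes_def Rm sw'.length_verts qe_def)
      have "s \<le> k \<and> s' \<le> k' \<or> k \<le> s \<and> k' \<le> s'" "t \<le> k \<and> t' \<le> k' \<or> k \<le> t \<and> k' \<le> t'"
        using common[of s s'] common[of t t'] st st' by auto
      \<comment> \<open>If \<open>x\<close> and \<open>y\<close> lay on different sides of the
        switches, both paths would order them alike. So both are on initial segments or both on
        final ones, and the compatibility of the \<open>P i\<close> or of the \<open>Q j\<close>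
        applies.\<close>
      then consider "t \<le> k" "s' \<le> k'" | "k \<le> s" "k' \<le> t'"
        using st(1) st'(1) by linarith
      then show False
      proof cases
        case 1
        have "precedes (P i) x y"
          unfolding precedes_def
          using 1 st c(3) len by (intro exI[of _ s] exI[of _ t]) (auto simp: sw.nth_initial)
        moreover have "precedes (P i') y x"
          unfolding precedes_def
          using 1 st' c'(3) len by (intro exI[of _ t'] exI[of _ s']) (auto simp: sw'.nth_initial)
        ultimately show False
          using P(3)[OF c(1) c'(1) ne(1)]
            order_compatible_iff[OF is_pathD(2)[OF P(1)[OF c(1)]] is_pathD(2)[OF P(1)[OF c'(1)]]]
          by blast
      next
        case 2
        have "precedes (Q j) x y"
          unfolding precedes_def
          using 2 st c(4) len
          by (intro exI[of _ "l + (s - k)"] exI[of _ "l + (t - k)"]) (auto simp: sw.nth_final)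
        moreover have "precedes (Q j') y x"
          unfolding precedes_def
          using 2 st' c'(4) len
          by (intro exI[of _ "l' + (t' - k')"] exI[of _ "l' + (s' - k')"]) (auto simp: sw'.nth_final)
        ultimately show False
          using Q(3)[OF c(2) c'(2) ne(2)]
            order_compatible_iff[OF is_pathD(2)[OF Q(1)[OF c(2)]] is_pathD(2)[OF Q(1)[OF c'(2)]]]
          by blast
      qed
    qed
    then show ?thesis
      using order_compatible_iff[OF dist] by blast
  qed

  \<comment> \<open>Obtaining \<delta> paths\<close>
  have "?I \<subseteq> fst ` M \<or> ?I \<subseteq> (fst \<circ> snd) ` M"
  proof (rule ccontr)
    assume "\<not> ?thesis"
    then obtain i j where ij: "i \<in> ?I" "j \<in> ?I" "i \<notin> fst ` M" "j \<notin> (fst \<circ> snd) ` M"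
      by blast
    \<comment> \<open>This is the switch at \<open>b\<close>, the end of \<open>P i\<close> and the
      start of \<open>Q j\<close>.\<close>
    have "(i, j, pe i, 0) \<in> C"
      using ij is_pathD(7)[OF P(1)] is_pathD(6)[OF Q(1)] by (auto simp: C_def pe_def)
    from stable[OF this] ij(3,4) show False
      by force
  qed
  \<comment> \<open>An inverse of whichever projection covers \<open>?I\<close>; in the second case
    the new paths are indexed by their final segments.\<close>
  then obtain f where f: "\<And>i. i \<in> ?I \<Longrightarrow> f i \<in> M" "inj_on f ?I"
    by (metis inj_on_inv_into inv_into_into subsetD)
  have "is_path G a c (R (f i))" if "i \<in> ?I" for i
    using R_path f(1) that by blast
  moreover have "edge_disjoint (R (f i)) (R (f j)) \<and> order_compatible (R (f i)) (R (f j))"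
    if "i \<in> ?I" "j \<in> ?I" "i \<noteq> j" for i j
    using R_disjoint R_compatible f that by (metis inj_onD)
  moreover have "a \<in> verts G" "c \<in> verts G"
    using assms by (auto simp: edge_rel_def)
  ultimately show ?thesis
    unfolding edge_rel_def by (auto intro!: exI[of _ "\<lambda>i. R (f i)"])
qed

theorem theorem1p3:
  fixes G :: "('v, 'e) multigraph" and \<delta> :: "'k rel"
  assumes "is_multigraph G" and "Card_order \<delta>"
  shows "equiv (verts G) (edge_rel G \<delta>)"
proof (rule equivI)
  show "edge_rel G \<delta> \<subseteq> verts G \<times> verts G"
    by (auto simp: edge_rel_def)
  show "refl_on (verts G) (edge_rel G \<delta>)"
    by (auto intro: refl_onI edge_rel_refl)
  show "sym (edge_rel G \<delta>)"
    by (auto intro: symI edge_rel_sym)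
  show "trans (edge_rel G \<delta>)"
    by (auto intro: transI edge_rel_trans)
qed

end
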